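(* Let $T_m$ be a Hermite multiplier that is bounded on $L^2(\mathbb{R}^n)$. Then $T_m$ is a compact operator on $L^2(\mathbb{R}^n)$ if and only if $\lim_{|\nu|\to\infty}m(\nu)=0$.
   Context: Hermite functions: for $k\in\mathbb{N}_0$, $t\in\mathbb{R}$, $\phi_k(t)=(2^k k!\sqrt\pi)^{-1/2}H_k(t)e^{-t^2/2}$ with $H_k(t)=(-1)^k e^{t^2}\frac{d^k}{dt^k}e^{-t^2}$; for $\nu\in\mathbb{N}_0^n$, $\phi_\nu(x)=\prod_{j=1}^n\phi_{\nu_j}(x_j)$; $\{\phi_\nu\}$ is an orthonormal basis of $L^2(\mathbb{R}^n)$. $\widehat f(\phi_\nu)=\int_{\mathbb{R}^n}f\phi_\nu\,dx$. For $m:\mathbb{N}_0^n\to\mathbb{C}$, the (Hermite) multiplier $T_m$ is $T_mf=\sum_{\nu\in\mathbb{N}_0^n}m(\nu)\widehat f(\phi_\nu)\phi_\nu$. $|\nu|=\nu_1+\cdots+\nu_n$. *)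

theory Defs
  imports "HOL-Analysis.Analysis" "HOL-Probability.Distributions"
begin

section \<open>Square-integrable functions\<close>

definition square_integrable :: "('a::euclidean_space \<Rightarrow> complex) \<Rightarrow> bool"
  where "square_integrable f \<longleftrightarrow>
    f \<in> borel_measurable lebesgue \<and> integrable lebesgue (\<lambda>x. (cmod (f x))\<^sup>2)"

lemma square_integrable_measurable:
  "square_integrable f \<Longrightarrow> f \<in> borel_measurable lebesgue"
  by (simp add: square_integrable_def)

lemma square_integrable_zero: "square_integrable (\<lambda>_. 0)"
  by (simp add: square_integrable_def)

lemma square_integrable_mult:
  assumes "square_integrable f"
  shows "square_integrable (\<lambda>x. c * f x)"
proof -
  have [measurable]: "f \<in> borel_measurable lebesgue"
    using assms by (rule square_integrable_measurable)
  show ?thesis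
    using assms by (auto simp: square_integrable_def norm_mult power_mult_distrib)
qed

lemma square_integrable_add:
  assumes "square_integrable f" "square_integrable g"
  shows "square_integrable (\<lambda>x. f x + g x)"
proof -
  have [measurable]: "f \<in> borel_measurable lebesgue" "g \<in> borel_measurable lebesgue"
    using assms by (auto dest: square_integrable_measurable)
  have "(cmod (f x + g x))\<^sup>2 \<le> 2 * (cmod (f x))\<^sup>2 + 2 * (cmod (g x))\<^sup>2" for x
  proof -
    have "(cmod (f x + g x))\<^sup>2 \<le> (cmod (f x) + cmod (g x))\<^sup>2"
      by (intro power_mono norm_triangle_ineq) auto
    also have "\<dots> \<le> 2 * (cmod (f x))\<^sup>2 + 2 * (cmod (g x))\<^sup>2"
      using sum_squares_bound[of "cmod (f x)" "cmod (g x)"] by (simp add: power2_sum)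
    finally show ?thesis .
  qed
  moreover have "integrable lebesgue (\<lambda>x. 2 * (cmod (f x))\<^sup>2 + 2 * (cmod (g x))\<^sup>2)"
    using assms by (auto simp: square_integrable_def)
  ultimately have "integrable lebesgue (\<lambda>x. (cmod (f x + g x))\<^sup>2)"
    by (intro Bochner_Integration.integrable_bound[where g = "\<lambda>x. (cmod (f x + g x))\<^sup>2"
        and f = "\<lambda>x. 2 * (cmod (f x))\<^sup>2 + 2 * (cmod (g x))\<^sup>2"]) auto
  then show ?thesis
    by (simp add: square_integrable_def)
qed

section \<open>The space \<open>L\<^sup>2\<close>\<close>

quotient_type (overloaded) 'a L2 = "'a::euclidean_space \<Rightarrow> complex" / partial:
  "\<lambda>f g. square_integrable f \<and> square_integrable g \<and> (AE x in lebesgue. f x = g x)"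
proof (rule part_equivpI)
  show "\<exists>f::'a \<Rightarrow> complex. square_integrable f \<and> square_integrable f \<and> (AE x in lebesgue. f x = f x)"
    using square_integrable_zero by auto
qed (auto intro!: sympI transpI elim: eventually_mono eventually_elim2)

lemma integral_square_cong:
  assumes "square_integrable f" "square_integrable g" "AE x in lebesgue. f x = g x"
  shows "(\<integral>x. (cmod (f x))\<^sup>2 \<partial>lebesgue) = (\<integral>x. (cmod (g x))\<^sup>2 \<partial>lebesgue)"
proof (rule integral_cong_AE)
  have [measurable]: "f \<in> borel_measurable lebesgue" "g \<in> borel_measurable lebesgue"
    using assms by (auto dest: square_integrable_measurable)
  show "(\<lambda>x. (cmod (f x))\<^sup>2) \<in> borel_measurable lebesgue"
       "(\<lambda>x. (cmod (g x))\<^sup>2) \<in> borel_measurable lebesgue"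
    by measurable
  show "AE x in lebesgue. (cmod (f x))\<^sup>2 = (cmod (g x))\<^sup>2"
    using assms(3) by eventually_elim simp
qed

lift_definition cscale :: "complex \<Rightarrow> 'a::euclidean_space L2 \<Rightarrow> 'a L2"
  is "\<lambda>c f x. c * f x"
  by (auto intro: square_integrable_mult elim: eventually_mono)

instantiation L2 :: (euclidean_space) real_vector
begin

lift_definition zero_L2 :: "'a L2" is "\<lambda>_. 0"
  by (simp add: square_integrable_zero)

lift_definition plus_L2 :: "'a L2 \<Rightarrow> 'a L2 \<Rightarrow> 'a L2" is "\<lambda>f g x. f x + g x"
  by (auto intro: square_integrable_add elim: eventually_elim2)

definition uminus_L2 :: "'a L2 \<Rightarrow> 'a L2" where "uminus_L2 f = cscale (- 1) f"

definition minus_L2 :: "'a L2 \<Rightarrow> 'a L2 \<Rightarrow> 'a L2" where "minus_L2 f g = f + (- g)"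

definition scaleR_L2 :: "real \<Rightarrow> 'a L2 \<Rightarrow> 'a L2" where "scaleR_L2 r f = cscale (of_real r) f"

instance
proof
  fix f g h :: "'a L2" and r s :: real
  show "f + g + h = f + (g + h)" "f + g = g + f" "0 + f = f"
    by (transfer; elim conjE; intro conjI square_integrable_add square_integrable_mult square_integrable_zero;
        (assumption | simp add: algebra_simps))+
  show "- f + f = 0"
    unfolding uminus_L2_def
    by (transfer; elim conjE; intro conjI square_integrable_add square_integrable_mult square_integrable_zero;
        (assumption | simp add: algebra_simps))
  show "f - g = f + - g"
    by (simp add: minus_L2_def)
  show "r *\<^sub>R (f + g) = r *\<^sub>R f + r *\<^sub>R g" "(r + s) *\<^sub>R f = r *\<^sub>R f + s *\<^sub>R f"
    "r *\<^sub>R s *\<^sub>R f = (r * s) *\<^sub>R f" "1 *\<^sub>R f = f"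
    unfolding scaleR_L2_def
    by (transfer; elim conjE; intro conjI square_integrable_add square_integrable_mult square_integrable_zero;
        (assumption | simp add: algebra_simps))+
qed

end

instantiation L2 :: (euclidean_space) real_normed_vector
begin

lift_definition norm_L2 :: "'a L2 \<Rightarrow> real"
  is "\<lambda>f. sqrt (\<integral>x. (cmod (f x))\<^sup>2 \<partial>lebesgue)"
  by (auto intro: integral_square_cong)

definition dist_L2 :: "'a L2 \<Rightarrow> 'a L2 \<Rightarrow> real" where "dist_L2 f g = norm (f - g)"

definition sgn_L2 :: "'a L2 \<Rightarrow> 'a L2" where "sgn_L2 f = f /\<^sub>R norm f"

definition uniformity_L2 :: "('a L2 \<times> 'a L2) filter"
  where "uniformity_L2 = (INF e\<in>{0<..}. principal {(f, g). dist f g < e})"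

definition open_L2 :: "'a L2 set \<Rightarrow> bool"
  where "open_L2 U = (\<forall>f\<in>U. eventually (\<lambda>(f', g). f' = f \<longrightarrow> g \<in> U) uniformity)"

lemma norm_L2_zero_iff: "norm f = 0 \<longleftrightarrow> f = 0" for f :: "'a L2"
proof (transfer, goal_cases)
  case (1 f)
  then have "integrable lebesgue (\<lambda>x. (cmod (f x))\<^sup>2)"
    by (simp add: square_integrable_def)
  from integral_nonneg_eq_0_iff_AE[OF this] show ?case
    using 1 by (simp add: square_integrable_zero)
qed

lemma norm_L2_cscale: "norm (cscale c f) = cmod c * norm f" for f :: "'a L2"
  by transfer (simp add: norm_mult power_mult_distrib real_sqrt_mult)

lemma norm_L2_nonneg: "0 \<le> norm f" for f :: "'a L2"
  by transfer simp

lemma norm_L2_add_pos: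
  fixes f g :: "'a L2"
  assumes "norm f > 0" "norm g > 0"
  shows "norm (f + g) \<le> norm f + norm g"
  using assms
proof (transfer, goal_cases)
  case (1 f g)
  define a b where "a = sqrt (\<integral>x. (cmod (f x))\<^sup>2 \<partial>lebesgue)"
    and "b = sqrt (\<integral>x. (cmod (g x))\<^sup>2 \<partial>lebesgue)"
  have ab: "a > 0" "b > 0"
    using 1 by (auto simp: a_def b_def)
  have sq: "a\<^sup>2 = (\<integral>x. (cmod (f x))\<^sup>2 \<partial>lebesgue)" "b\<^sup>2 = (\<integral>x. (cmod (g x))\<^sup>2 \<partial>lebesgue)"
    by (auto simp: a_def b_def)
  have fg: "square_integrable f" "square_integrable g" "square_integrable (\<lambda>x. f x + g x)"
    using 1 by (auto intro: square_integrable_add)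
  have pt: "(cmod (f x + g x))\<^sup>2 \<le> (1 + b / a) * (cmod (f x))\<^sup>2 + (1 + a / b) * (cmod (g x))\<^sup>2" for x
  proof -
    define u v where "u = cmod (f x)" and "v = cmod (g x)"
    have eq: "(1 + b / a) * u\<^sup>2 + (1 + a / b) * v\<^sup>2 - (u + v)\<^sup>2 = (b * u - a * v)\<^sup>2 / (a * b)"
      using ab by (simp add: field_simps power2_eq_square)
    have "(b * u - a * v)\<^sup>2 / (a * b) \<ge> 0"
      using ab by (intro divide_nonneg_pos) auto
    have "(cmod (f x + g x))\<^sup>2 \<le> (u + v)\<^sup>2"
      unfolding u_def v_def by (intro power_mono norm_triangle_ineq) auto
    also have "\<dots> \<le> (1 + b / a) * u\<^sup>2 + (1 + a / b) * v\<^sup>2"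
      using eq \<open>(b * u - a * v)\<^sup>2 / (a * b) \<ge> 0\<close> by linarith
    finally show ?thesis
      by (simp add: u_def v_def)
  qed
  have "(\<integral>x. (cmod (f x + g x))\<^sup>2 \<partial>lebesgue) \<le>
      (\<integral>x. (1 + b / a) * (cmod (f x))\<^sup>2 + (1 + a / b) * (cmod (g x))\<^sup>2 \<partial>lebesgue)"
    using fg pt by (intro integral_mono) (auto simp: square_integrable_def)
  also have "\<dots> = (1 + b / a) * a\<^sup>2 + (1 + a / b) * b\<^sup>2"
    using fg by (simp add: square_integrable_def sq)
  also have "\<dots> = (a + b)\<^sup>2"
    using ab by (simp add: field_simps power2_eq_square)
  finally have "sqrt (\<integral>x. (cmod (f x + g x))\<^sup>2 \<partial>lebesgue) \<le> a + b"
    using ab by (intro real_le_lsqrt) auto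
  then show ?case
    by (simp add: a_def b_def)
qed

instance
proof
  fix f g :: "'a L2" and r :: real and U :: "'a L2 set"
  show "dist f g = norm (f - g)"
    by (rule dist_L2_def)
  show "sgn f = f /\<^sub>R norm f"
    by (rule sgn_L2_def)
  show "uniformity = (INF e\<in>{0<..}. principal {(f, g). dist f g < (e::real)} :: ('a L2 \<times> 'a L2) filter)"
    by (rule uniformity_L2_def)
  show "open U = (\<forall>f\<in>U. eventually (\<lambda>(f', g). f' = f \<longrightarrow> g \<in> U) uniformity)"
    by (rule open_L2_def)
  show "norm f = 0 \<longleftrightarrow> f = 0"
    by (rule norm_L2_zero_iff)
  show "norm (r *\<^sub>R f) = \<bar>r\<bar> * norm f"
    by (simp add: scaleR_L2_def norm_L2_cscale)
  show "norm (f + g) \<le> norm f + norm g"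
  proof (cases "norm f > 0 \<and> norm g > 0")
    case True
    then show ?thesis by (simp add: norm_L2_add_pos)
  next
    case False
    then have "norm f = 0 \<or> norm g = 0"
      using norm_L2_nonneg[of f] norm_L2_nonneg[of g] by linarith
    then have "f = 0 \<or> g = 0"
      by (simp only: norm_L2_zero_iff)
    then show ?thesis
      using norm_L2_nonneg[of f] norm_L2_nonneg[of g] by (elim disjE) simp_all
  qed
qed

end

section \<open>Hermite functions\<close>

definition hermite_poly :: "nat \<Rightarrow> real \<Rightarrow> real"
  where "hermite_poly k t = (- 1) ^ k * exp (t\<^sup>2) * (deriv ^^ k) (\<lambda>s. exp (- s\<^sup>2)) t"

definition hermite_fun :: "nat \<Rightarrow> real \<Rightarrow> real"
  where "hermite_fun k t =
    (2 ^ k * fact k * sqrt pi) powr (- 1 / 2) * hermite_poly k t * exp (- t\<^sup>2 / 2)"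

definition hermite_fun_vec :: "nat ^ 'n \<Rightarrow> real ^ 'n \<Rightarrow> complex"
  where "hermite_fun_vec \<nu> x = complex_of_real (\<Prod>j\<in>UNIV. hermite_fun (\<nu> $ j) (x $ j))"

lemma iterated_deriv_gauss:
  "\<exists>p. (deriv ^^ k) (\<lambda>s::real. exp (- s\<^sup>2)) = (\<lambda>t. poly p t * exp (- t\<^sup>2))"
proof (induction k)
  case 0
  show ?case by (rule exI[of _ 1]) simp
next
  case (Suc k)
  then obtain p where p: "(deriv ^^ k) (\<lambda>s::real. exp (- s\<^sup>2)) = (\<lambda>t. poly p t * exp (- t\<^sup>2))"
    by blast
  have "((\<lambda>t. poly p t * exp (- t\<^sup>2)) has_real_derivative
      poly (pderiv p - [:0, 2:] * p) t * exp (- t\<^sup>2)) (at t)" for t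
    by (auto intro!: derivative_eq_intros simp: algebra_simps)
  then have "deriv (\<lambda>t. poly p t * exp (- t\<^sup>2)) = (\<lambda>t. poly (pderiv p - [:0, 2:] * p) t * exp (- t\<^sup>2))"
    by (intro ext DERIV_imp_deriv)
  with p have "(deriv ^^ Suc k) (\<lambda>s::real. exp (- s\<^sup>2)) =
      (\<lambda>t. poly (pderiv p - [:0, 2:] * p) t * exp (- t\<^sup>2))"
    by (simp only: funpow.simps comp_apply)
  then show ?case by blast
qed

lemma hermite_poly_eq_poly: "\<exists>p. hermite_poly k = poly p"
proof -
  obtain p where p: "(deriv ^^ k) (\<lambda>s::real. exp (- s\<^sup>2)) = (\<lambda>t. poly p t * exp (- t\<^sup>2))"
    using iterated_deriv_gauss by blast
  have "hermite_poly k t = poly (smult ((- 1) ^ k) p) t" for t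
    using exp_add[of "t\<^sup>2" "- t\<^sup>2"] by (simp add: hermite_poly_def p mult_ac)
  then show ?thesis by blast
qed

lemma continuous_on_hermite_fun: "continuous_on UNIV (hermite_fun k)"
proof -
  obtain p where "hermite_poly k = poly p"
    using hermite_poly_eq_poly by blast
  then show ?thesis
    unfolding hermite_fun_def by (auto intro!: continuous_intros)
qed

lemma integrable_poly_gauss: "integrable lborel (\<lambda>t::real. poly p t * exp (- t\<^sup>2))"
proof -
  have "integrable lborel (\<lambda>t::real. sqrt pi * (normal_density 0 (1 / sqrt 2) t * t ^ i))" for i
    using integrable_normal_moment[of "1 / sqrt 2" 0 i] by simp
  moreover have "sqrt pi * (normal_density 0 (1 / sqrt 2) t * t ^ i) = t ^ i * exp (- t\<^sup>2)" for t :: real and i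
    by (simp add: normal_density_def power_divide)
  ultimately have "integrable lborel (\<lambda>t::real. \<Sum>i\<le>degree p. coeff p i * (t ^ i * exp (- t\<^sup>2)))"
    by auto
  then show ?thesis
    unfolding poly_altdef sum_distrib_right mult.assoc .
qed

lemma integrable_hermite_fun_sq: "integrable lborel (\<lambda>t. (hermite_fun k t)\<^sup>2)"
proof -
  obtain p where p: "hermite_poly k = poly p"
    using hermite_poly_eq_poly by blast
  define c where "c = (2 ^ k * fact k * sqrt pi) powr (- 1 / 2)"
  have "(exp (- t\<^sup>2 / 2))\<^sup>2 = exp (- t\<^sup>2)" for t :: real
    by (simp flip: exp_double)
  then have "(\<lambda>t. (hermite_fun k t)\<^sup>2) = (\<lambda>t. poly (smult (c\<^sup>2) (p\<^sup>2)) t * exp (- t\<^sup>2))"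
    by (simp add: hermite_fun_def p c_def power_mult_distrib poly_power fun_eq_iff)
  then show ?thesis
    using integrable_poly_gauss[of "smult (c\<^sup>2) (p\<^sup>2)"] by simp
qed

lemma hermite_fun_vec_measurable: "hermite_fun_vec \<nu> \<in> borel_measurable borel"
  unfolding hermite_fun_vec_def
  by (intro borel_measurable_continuous_onI continuous_intros
      continuous_on_compose2[OF continuous_on_hermite_fun]) auto

lemma square_integrable_hermite_fun_vec: "square_integrable (hermite_fun_vec \<nu>)"
  for \<nu> :: "nat ^ 'n"
proof -
  define j where "j b = (THE i. b = axis i (1::real))" for b :: "real ^ 'n"
  have j [simp]: "j (axis i 1) = i" for i
    by (auto simp: j_def axis_eq_axis)
  have Basis: "(Basis :: (real ^ 'n) set) = range (\<lambda>i. axis i 1)"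
    by (auto simp: Basis_vec_def)
  have inj: "inj (\<lambda>i::'n. axis i (1::real))"
    by (auto simp: inj_def axis_eq_axis)
  have m [measurable]: "hermite_fun k \<in> borel_measurable borel" for k
    by (rule borel_measurable_continuous_onI[OF continuous_on_hermite_fun])
  have eq: "(cmod (hermite_fun_vec \<nu> x))\<^sup>2 = (\<Prod>b\<in>Basis. (hermite_fun (\<nu> $ j b) (x \<bullet> b))\<^sup>2)" for x
    unfolding Basis
    by (simp add: prod.reindex[OF inj] hermite_fun_vec_def inner_axis prod_power_distrib
        del: of_real_prod)
  have "(\<integral>\<^sup>+x. ennreal ((cmod (hermite_fun_vec \<nu> x))\<^sup>2) \<partial>lborel) =
      (\<integral>\<^sup>+x. (\<Prod>b\<in>Basis. ennreal ((hermite_fun (\<nu> $ j b) (x \<bullet> b))\<^sup>2)) \<partial>lborel)"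
    unfolding eq by (intro nn_integral_cong) (simp add: prod_ennreal)
  also have "\<dots> = (\<Prod>b\<in>(Basis :: (real ^ 'n) set). \<integral>\<^sup>+t. ennreal ((hermite_fun (\<nu> $ j b) t)\<^sup>2) \<partial>lborel)"
    by (rule nn_integral_lborel_prod) auto
  also have "\<dots> < \<infinity>"
    using integrable_hermite_fun_sq
    by (auto simp: ennreal_prod_eq_top real_integrable_def less_top[symmetric] integrable_iff_bounded)
  finally have "integrable lborel (\<lambda>x. (cmod (hermite_fun_vec \<nu> x))\<^sup>2)"
    using hermite_fun_vec_measurable[of \<nu>] by (intro integrableI_bounded) auto
  then show ?thesis
    using hermite_fun_vec_measurable[of \<nu>]
    by (auto simp: square_integrable_def integrable_completion intro: measurable_completion)
qed

lift_definition hermite_L2 :: "nat ^ 'n \<Rightarrow> (real ^ 'n) L2" is hermite_fun_vec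
  by (simp add: square_integrable_hermite_fun_vec)

lift_definition hermite_coeff :: "(real ^ 'n) L2 \<Rightarrow> nat ^ 'n \<Rightarrow> complex"
  is "\<lambda>f \<nu>. \<integral>x. f x * hermite_fun_vec \<nu> x \<partial>lebesgue"
proof (intro ext integral_cong_AE)
  fix f g :: "real ^ 'n \<Rightarrow> complex" and \<nu> :: "nat ^ 'n"
  assume *: "square_integrable f \<and> square_integrable g \<and> (AE x in lebesgue. f x = g x)"
  then have [measurable]: "f \<in> borel_measurable lebesgue" "g \<in> borel_measurable lebesgue"
      "hermite_fun_vec \<nu> \<in> borel_measurable lebesgue"
    using square_integrable_hermite_fun_vec by (auto dest: square_integrable_measurable)
  show "(\<lambda>x. f x * hermite_fun_vec \<nu> x) \<in> borel_measurable lebesgue"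
       "(\<lambda>x. g x * hermite_fun_vec \<nu> x) \<in> borel_measurable lebesgue"
    by measurable
  show "AE x in lebesgue. f x * hermite_fun_vec \<nu> x = g x * hermite_fun_vec \<nu> x"
    using * by (auto elim: eventually_mono)
qed

section \<open>Hermite multipliers\<close>

definition hermite_term :: "(nat ^ 'n \<Rightarrow> complex) \<Rightarrow> (real ^ 'n) L2 \<Rightarrow> nat ^ 'n \<Rightarrow> (real ^ 'n) L2"
  where "hermite_term m f \<nu> = cscale (m \<nu> * hermite_coeff f \<nu>) (hermite_L2 \<nu>)"

text \<open>The sum is unconditional convergence in the \<open>L\<^sup>2\<close>-norm; \<^const>\<open>infsum\<close> is \<open>0\<close> where the
  series diverges, so boundedness below demands convergence explicitly.\<close>

definition hermite_multiplier :: "(nat ^ 'n \<Rightarrow> complex) \<Rightarrow> (real ^ 'n) L2 \<Rightarrow> (real ^ 'n) L2"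
  where "hermite_multiplier m f = (\<Sum>\<^sub>\<infinity>\<nu>. hermite_term m f \<nu>)"

definition hermite_multiplier_bounded :: "(nat ^ 'n \<Rightarrow> complex) \<Rightarrow> bool"
  where "hermite_multiplier_bounded m \<longleftrightarrow>
    (\<forall>f. hermite_term m f summable_on UNIV) \<and>
    (\<exists>C. \<forall>f. norm (hermite_multiplier m f) \<le> C * norm f)"

text \<open>Complex linearity is spelled out because the type class of \<open>L2\<close> only knows real scalars.\<close>

definition compact_operator :: "('a::euclidean_space L2 \<Rightarrow> 'a L2) \<Rightarrow> bool"
  where "compact_operator T \<longleftrightarrow>
    (\<forall>f g. T (f + g) = T f + T g) \<and> (\<forall>c f. T (cscale c f) = cscale c (T f)) \<and>
    (\<forall>B. bounded B \<longrightarrow> compact (closure (T ` B)))"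

definition multi_index_abs :: "nat ^ 'n \<Rightarrow> nat"
  where "multi_index_abs \<nu> = (\<Sum>j\<in>UNIV. \<nu> $ j)"

end

theory Submission
  imports Defs "HOL-Real_Asymp.Real_Asymp"
begin

text \<open>
  The Hermite functions are orthonormal, since multiplication by \<open>2t\<close> minus differentiation is
  adjoint to differentiation for the weight \<open>exp (- t\<^sup>2)\<close>. Hence \<open>T\<^sub>m\<close> differs from its truncation to
  the finite set where \<open>\<bar>m\<bar> \<ge> e\<close> by an operator of norm at most \<open>e\<close> (Bessel's inequality); if \<open>m\<close>
  tends to \<open>0\<close>, the image of a bounded set is thus totally bounded, and \<open>L\<^sup>2\<close> is complete.
  Conversely the vectors \<open>T\<^sub>m \<phi>\<^sub>\<nu> = m(\<nu>) \<phi>\<^sub>\<nu>\<close> with \<open>\<bar>m(\<nu>)\<bar> \<ge> e\<close> are \<open>e\<close>-separated, so a compact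
  \<open>T\<^sub>m\<close> admits only finitely many of them.
\<close>

section \<open>Orthonormality of the Hermite functions\<close>

text \<open>The physicists' Hermite polynomials, as formal polynomials so that \<open>pderiv\<close>
  and induction apply. The recursion is the raising operator, whose adjoint for the Gaussian weight
  is differentiation.\<close>

fun herm_poly :: "nat \<Rightarrow> real poly"
  where
    "herm_poly 0 = 1"
  | "herm_poly (Suc k) = [:0, 2:] * herm_poly k - pderiv (herm_poly k)"

text \<open>Differentiating \<open>poly p t * exp (- t\<^sup>2)\<close> replaces \<open>p\<close> by
  \<open>pderiv p - [:0, 2:] * p\<close>, the negative of the raising operator; hence the
  sign.\<close>

lemma iterated_deriv_gauss_eq:
  "(deriv ^^ k) (\<lambda>s::real. exp (- s\<^sup>2)) = (\<lambda>t. (- 1) ^ k * poly (herm_poly k) t * exp (- t\<^sup>2))"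
proof (induction k)
  case 0
  show ?case by simp
next
  case (Suc k)
  have "((\<lambda>t. (- 1) ^ k * poly (herm_poly k) t * exp (- t\<^sup>2)) has_real_derivative
      (- 1) ^ Suc k * poly (herm_poly (Suc k)) t * exp (- t\<^sup>2)) (at t)" for t
    by (auto intro!: derivative_eq_intros simp: algebra_simps)
  then have "deriv (\<lambda>t. (- 1) ^ k * poly (herm_poly k) t * exp (- t\<^sup>2)) =
      (\<lambda>t. (- 1) ^ Suc k * poly (herm_poly (Suc k)) t * exp (- t\<^sup>2))"
    by (intro ext DERIV_imp_deriv)
  with Suc.IH show ?case
    by (simp only: funpow.simps comp_apply)
qed

lemma hermite_poly_eq: "hermite_poly k = poly (herm_poly k)"
proof
  fix t :: real
  have "hermite_poly k t = ((- 1) ^ k * (- 1) ^ k) * (exp (t\<^sup>2) * exp (- t\<^sup>2)) * poly (herm_poly k) t"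
    by (simp only: hermite_poly_def iterated_deriv_gauss_eq mult_ac)
  also have "(- 1) ^ k * (- 1) ^ k = (1::real)"
    by (simp flip: power_mult_distrib)
  also have "exp (t\<^sup>2) * exp (- t\<^sup>2) = 1"
    by (simp flip: exp_add)
  finally show "hermite_poly k t = poly (herm_poly k) t"
    by simp
qed

text \<open>Lowering relation. In the differentiated recursion the induction hypothesis turns the
  last two terms into \<open>2 * real (Suc k)\<close> times the raising operator applied to
  \<open>herm_poly k\<close>, which is \<open>herm_poly (Suc k)\<close> again.\<close>

lemma pderiv_herm_poly: "pderiv (herm_poly (Suc k)) = smult (2 * real (Suc k)) (herm_poly k)"
proof (induction k)
  case 0
  show ?case by (simp add: pderiv_pCons)
next
  case (Suc k)
  have "pderiv (herm_poly (Suc (Suc k))) = smult 2 (herm_poly (Suc k)) +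
      [:0, 2:] * pderiv (herm_poly (Suc k)) - pderiv (pderiv (herm_poly (Suc k)))"
    by (subst herm_poly.simps(2)) (simp add: pderiv_diff pderiv_mult pderiv_pCons pderiv_smult del: herm_poly.simps)
  also have "\<dots> = smult 2 (herm_poly (Suc k)) + smult (2 * real (Suc k)) (herm_poly (Suc k))"
    by (simp only: Suc.IH pderiv_smult) (simp add: smult_diff_right)
  also have "\<dots> = smult (2 * real (Suc (Suc k))) (herm_poly (Suc k))"
    by (simp only: smult_add_left [symmetric]) (simp del: herm_poly.simps)
  finally show ?case .
qed

section \<open>Integration by parts for the Gaussian weight\<close>

lemma poly_gauss_tendsto_0:
  "((\<lambda>t::real. poly p t * exp (- t\<^sup>2)) \<longlongrightarrow> 0) at_top"
  "((\<lambda>t::real. poly p t * exp (- t\<^sup>2)) \<longlongrightarrow> 0) at_bot"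
proof -
  have "((\<lambda>t::real. t ^ i * exp (- t\<^sup>2)) \<longlongrightarrow> 0) at_top" 
    "((\<lambda>t::real. t ^ i * exp (- t\<^sup>2)) \<longlongrightarrow> 0) at_bot" for i
    by real_asymp+
  then have "((\<lambda>t::real. \<Sum>i\<le>degree p. coeff p i * (t ^ i * exp (- t\<^sup>2))) \<longlongrightarrow> 0) at_top"
    "((\<lambda>t::real. \<Sum>i\<le>degree p. coeff p i * (t ^ i * exp (- t\<^sup>2))) \<longlongrightarrow> 0) at_bot"
    by (auto intro!: tendsto_null_sum tendsto_mult_right_zero)
  then show "((\<lambda>t::real. poly p t * exp (- t\<^sup>2)) \<longlongrightarrow> 0) at_top"
    "((\<lambda>t::real. poly p t * exp (- t\<^sup>2)) \<longlongrightarrow> 0) at_bot"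
    by (simp_all add: poly_altdef sum_distrib_right mult.assoc)
qed

text \<open>The integrand is the derivative of \<open>poly p t * exp (- t\<^sup>2)\<close>, which
  vanishes at both infinities.\<close>

lemma integral_deriv_poly_gauss:
  "(\<integral>t. poly (pderiv p - [:0, 2:] * p) t * exp (- t\<^sup>2) \<partial>lborel) = (0::real)"
proof -
  have "(LBINT t=-\<infinity>..\<infinity>. poly (pderiv p - [:0, 2:] * p) t * exp (- t\<^sup>2)) = 0 - (0::real)"
  proof (rule interval_integral_FTC_integrable)
    show "((\<lambda>t. poly p t * exp (- t\<^sup>2)) has_vector_derivative
      poly (pderiv p - [:0, 2:] * p) t * exp (- t\<^sup>2)) (at t)" for t
      unfolding has_real_derivative_iff_has_vector_derivative [symmetric]
      by (auto intro!: derivative_eq_intros simp: algebra_simps)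
    show "set_integrable lborel (einterval (-\<infinity>) \<infinity>) (\<lambda>t. poly (pderiv p - [:0, 2:] * p) t * exp (- t\<^sup>2))"
      using integrable_poly_gauss by (simp add: set_integrable_def del: poly_diff poly_mult)
  next
    show "(((\<lambda>t. poly p t * exp (- t\<^sup>2)) \<circ> real_of_ereal) \<longlongrightarrow> 0) (at_right (-\<infinity>))"
      using poly_gauss_tendsto_0(2)[of p] by (simp add: at_right_MInf filterlim_filtermap comp_def)
    show "(((\<lambda>t. poly p t * exp (- t\<^sup>2)) \<circ> real_of_ereal) \<longlongrightarrow> 0) (at_left \<infinity>)"
      using poly_gauss_tendsto_0(1)[of p] by (simp add: at_left_PInf filterlim_filtermap comp_def)
  qed (auto intro!: continuous_intros)
  then show ?thesis
    by (simp add: interval_lebesgue_integral_def set_lebesgue_integral_def)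
qed

lemma integral_gauss: "(\<integral>t. exp (- t\<^sup>2) \<partial>lborel) = sqrt pi"
proof -
  have "has_bochner_integral lborel (\<lambda>t::real. exp (- t\<^sup>2)) (2 * (sqrt pi / 2))"
    using has_bochner_integral_even_function[OF gaussian_moment_0] by simp
  then show ?thesis
    by (simp add: has_bochner_integral_iff)
qed

definition gauss_inner :: "real poly \<Rightarrow> real poly \<Rightarrow> real"
  where "gauss_inner p q = (\<integral>t. poly (p * q) t * exp (- t\<^sup>2) \<partial>lborel)"

lemma gauss_inner_commute: "gauss_inner p q = gauss_inner q p"
  by (simp add: gauss_inner_def mult.commute)

text \<open>Integration by parts: the two integrands differ, up to sign, by the derivative of
  \<open>p * q\<close> times the weight, and that has integral 0.\<close>

lemma gauss_inner_raise: "gauss_inner ([:0, 2:] * p - pderiv p) q = gauss_inner p (pderiv q)"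
proof -
  have "([:0, 2:] * p - pderiv p) * q = p * pderiv q - (pderiv (p * q) - [:0, 2:] * (p * q))"
    by (simp add: pderiv_mult algebra_simps)
  then have "gauss_inner ([:0, 2:] * p - pderiv p) q =
      (\<integral>t. poly (p * pderiv q) t * exp (- t\<^sup>2) -
        poly (pderiv (p * q) - [:0, 2:] * (p * q)) t * exp (- t\<^sup>2) \<partial>lborel)"
    unfolding gauss_inner_def by (simp only: poly_diff left_diff_distrib)
  also have "\<dots> = gauss_inner p (pderiv q) - 0"
    unfolding gauss_inner_def
    by (subst Bochner_Integration.integral_diff)
      (rule integrable_poly_gauss, rule integrable_poly_gauss, simp only: integral_deriv_poly_gauss)
  finally show ?thesis by simp
qed

text \<open>Moving one raising operator across as a derivative lowers both indices by one, with a
  factor of twice the second index; these factors build up \<open>2 ^ k * fact k\<close>. Since both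
  indices fall together, \<open>k\<close> must be arbitrary in the induction.\<close>

lemma gauss_inner_herm_poly:
  "gauss_inner (herm_poly j) (herm_poly k) = (if j = k then 2 ^ k * fact k * sqrt pi else 0)"
proof (induction j arbitrary: k)
  case 0
  show ?case
  proof (cases k)
    case 0
    then show ?thesis
      by (simp add: gauss_inner_def integral_gauss)
  next
    case (Suc i)
    \<comment> \<open>By symmetry the raising operator of the other factor lands on the constant 1
      as a derivative, giving 0.\<close>
    have "gauss_inner 1 (herm_poly (Suc i)) = gauss_inner (herm_poly i) (pderiv 1)"
      by (simp only: gauss_inner_commute[of 1] herm_poly.simps(2) gauss_inner_raise)
    then show ?thesis
      using Suc by (simp add: gauss_inner_def)
  qed
next
  case (Suc j)
  have gauss_inner_0: "gauss_inner p 0 = 0" for p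
    by (simp add: gauss_inner_def)
  have raise: "gauss_inner (herm_poly (Suc j)) (herm_poly k) = gauss_inner (herm_poly j) (pderiv (herm_poly k))"
    by (simp only: herm_poly.simps(2) gauss_inner_raise)
  show ?case
  proof (cases k)
    case 0
    then show ?thesis
      unfolding raise by (simp add: gauss_inner_0)
  next
    case (Suc i)
    have "gauss_inner (herm_poly j) (smult (2 * real (Suc i)) (herm_poly i)) =
        2 * real (Suc i) * gauss_inner (herm_poly j) (herm_poly i)"
      by (simp add: gauss_inner_def mult.assoc)
    then show ?thesis
      unfolding raise unfolding Suc pderiv_herm_poly Suc.IH by (simp add: algebra_simps)
  qed
qed

section \<open>Orthonormal Hermite functions in one variable\<close>

lemma hermite_fun_mult:
  "hermite_fun j t * hermite_fun k t =
    (2 ^ j * fact j * sqrt pi) powr (- 1 / 2) * (2 ^ k * fact k * sqrt pi) powr (- 1 / 2) *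
    (poly (herm_poly j * herm_poly k) t * exp (- t\<^sup>2))"
proof -
  have "exp (- t\<^sup>2 / 2) * exp (- t\<^sup>2 / 2) = exp (- t\<^sup>2)"
    by (simp flip: exp_add)
  then show ?thesis
    by (simp add: hermite_fun_def hermite_poly_eq mult_ac)
qed

lemma integrable_hermite_fun_mult: "integrable lborel (\<lambda>t. hermite_fun j t * hermite_fun k t)"
  unfolding hermite_fun_mult by (intro integrable_mult_right integrable_poly_gauss)

lemma hermite_fun_orthonormal:
  "(\<integral>t. hermite_fun j t * hermite_fun k t \<partial>lborel) = (if j = k then 1 else 0)"
proof -
  define c where "c k = (2 ^ k * fact k * sqrt pi :: real)" for k
  have "c k > 0"
    by (simp add: c_def)
  have "(\<integral>t. hermite_fun j t * hermite_fun k t \<partial>lborel) =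
      c j powr (- 1 / 2) * c k powr (- 1 / 2) * gauss_inner (herm_poly j) (herm_poly k)"
    unfolding hermite_fun_mult gauss_inner_def c_def
    by (rule integral_mult_right_zero)
  also have "\<dots> = (if j = k then c k powr (- 1 / 2) * c k powr (- 1 / 2) * c k else 0)"
    unfolding gauss_inner_herm_poly c_def by simp
  \<comment> \<open>\<open>c k\<close> is the squared weighted norm of \<open>herm_poly k\<close>,
    so the power \<open>- 1 / 2\<close> in \<open>hermite_fun\<close> is exactly the
    normalisation.\<close>
  also have "c k powr (- 1 / 2) * c k powr (- 1 / 2) * c k = 1"
    using \<open>c k > 0\<close> by (simp add: powr_minus field_simps del: powr_half_sqrt_powr flip: powr_add)
  finally show ?thesis .
qed

text \<open>Fubini for tensor products: \<open>lborel\<close> on a Euclidean space is the image of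
  the product measure indexed by \<open>Basis\<close> under the map from coordinates to
  vectors.\<close>

lemma integral_lborel_prod:
  fixes f :: "'a::euclidean_space \<Rightarrow> real \<Rightarrow> real"
  assumes "\<And>b. b \<in> Basis \<Longrightarrow> integrable lborel (f b)"
  shows "(\<integral>x. (\<Prod>b\<in>Basis. f b (x \<bullet> b)) \<partial>lborel) = (\<Prod>b\<in>Basis. \<integral>t. f b t \<partial>lborel)"
proof -
  interpret product_sigma_finite "\<lambda>_::'a. lborel :: real measure"
    by standard
  have [measurable]: "b \<in> Basis \<Longrightarrow> f b \<in> borel_measurable borel" for b
    using assms[of b] by (auto dest: borel_measurable_integrable)
  have "(\<integral>x. (\<Prod>b\<in>Basis. f b (x \<bullet> b)) \<partial>lborel) =
      (\<integral>x. (\<Prod>b\<in>Basis. f b ((\<Sum>c\<in>Basis. x c *\<^sub>R c) \<bullet> b)) \<partial>(\<Pi>\<^sub>M b\<in>(Basis::'a set). lborel))"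
    by (subst lborel_eq, subst integral_distr) simp_all
  also have "\<dots> = (\<integral>x. (\<Prod>b\<in>Basis. f b (x b)) \<partial>(\<Pi>\<^sub>M b\<in>(Basis::'a set). lborel))"
    by (intro Bochner_Integration.integral_cong prod.cong)
      (simp_all add: inner_sum_left inner_Basis if_distrib sum.delta cong: if_cong)
  also have "\<dots> = (\<Prod>b\<in>Basis. \<integral>t. f b t \<partial>lborel)"
    using assms by (intro product_integral_prod) auto
  finally show ?thesis .
qed

lemma hermite_fun_vec_orthonormal:
  fixes \<mu> \<nu> :: "nat ^ 'n"
  shows "(\<integral>x. hermite_fun_vec \<mu> x * hermite_fun_vec \<nu> x \<partial>lebesgue) = (if \<mu> = \<nu> then 1 else 0)"
proof -
  define j where "j b = (THE i. b = axis i (1::real))" for b :: "real ^ 'n"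
  have j [simp]: "j (axis i 1) = i" for i
    by (auto simp: j_def axis_eq_axis)
  have Basis: "(Basis :: (real ^ 'n) set) = range (\<lambda>i. axis i 1)"
    by (auto simp: Basis_vec_def)
  have inj: "inj (\<lambda>i::'n. axis i (1::real))"
    by (auto simp: inj_def axis_eq_axis)
  have eq: "hermite_fun_vec \<mu> x * hermite_fun_vec \<nu> x = complex_of_real
      (\<Prod>b\<in>Basis. hermite_fun (\<mu> $ j b) (x \<bullet> b) * hermite_fun (\<nu> $ j b) (x \<bullet> b))" for x
    unfolding Basis
    by (simp add: prod.reindex[OF inj] hermite_fun_vec_def inner_axis prod.distrib)
  have "(\<integral>x. hermite_fun_vec \<mu> x * hermite_fun_vec \<nu> x \<partial>lebesgue) =
      (\<integral>x. hermite_fun_vec \<mu> x * hermite_fun_vec \<nu> x \<partial>lborel)"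
    using hermite_fun_vec_measurable[of \<mu>] hermite_fun_vec_measurable[of \<nu>]
    by (intro integral_completion) simp
  also have "\<dots> = complex_of_real (\<Prod>b\<in>(Basis :: (real ^ 'n) set).
      \<integral>t. hermite_fun (\<mu> $ j b) t * hermite_fun (\<nu> $ j b) t \<partial>lborel)"
    unfolding eq integral_complex_of_real
    by (subst integral_lborel_prod) (auto intro: integrable_hermite_fun_mult)
  also have "\<dots> = (\<Prod>i\<in>UNIV. if \<mu> $ i = \<nu> $ i then 1 else 0)"
    unfolding Basis hermite_fun_orthonormal by (simp add: prod.reindex[OF inj] if_distrib cong: if_cong)
  also have "\<dots> = (if \<mu> = \<nu> then 1 else 0)"
    by (auto simp: vec_eq_iff)
  finally show ?thesis .
qed

section \<open>Completeness of \<open>L\<^sup>2\<close>\<close>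

text \<open>The quotient is partial, so a representative has to come with its square integrability
  before the \<open>abs_eq\<close> equations apply.\<close>

lemma L2_cases:
  fixes F :: "'a::euclidean_space L2"
  obtains f where "square_integrable f" "F = abs_L2 f"
  using Quotient_rep_reflp[OF Quotient_L2] Quotient_abs_rep[OF Quotient_L2] by metis

lemma norm_abs_L2:
  "square_integrable f \<Longrightarrow> norm (abs_L2 f) = sqrt (\<integral>x. (cmod (f x))\<^sup>2 \<partial>lebesgue)"
  by (simp add: norm_L2.abs_eq)

lemma square_integrable_diff:
  assumes "square_integrable f" "square_integrable g"
  shows "square_integrable (\<lambda>x. f x - g x)"
  using square_integrable_add[OF assms(1) square_integrable_mult[OF assms(2), of "-1"]] by simp

lemma diff_abs_L2:
  assumes "square_integrable f" "square_integrable g"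
  shows "abs_L2 f - abs_L2 g = abs_L2 (\<lambda>x. f x - g x)"
  using assms square_integrable_mult[OF assms(2), of "-1"]
  by (simp add: minus_L2_def uminus_L2_def cscale.abs_eq plus_L2.abs_eq)

lemma nn_integral_square_abs_L2:
  assumes "square_integrable f"
  shows "(\<integral>\<^sup>+x. ennreal ((cmod (f x))\<^sup>2) \<partial>lebesgue) = ennreal ((norm (abs_L2 f))\<^sup>2)"
  using assms
  by (simp add: norm_abs_L2 square_integrable_def nn_integral_eq_integral)

lemma square_integrable_iff_nn_integral:
  "square_integrable f \<longleftrightarrow> f \<in> borel_measurable lebesgue \<and>
    (\<integral>\<^sup>+x. ennreal ((cmod (f x))\<^sup>2) \<partial>lebesgue) < \<infinity>"
  by (auto simp: square_integrable_def integrable_iff_bounded)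

text \<open>Core of Riesz-Fischer: a weighted sum of the squared increments has finite integral,
  hence is finite almost everywhere, which forces geometric decay of the increments there.\<close>

lemma AE_convergent_of_fast_Cauchy:
  fixes u :: "nat \<Rightarrow> 'a::euclidean_space \<Rightarrow> complex"
  assumes u: "\<And>n. square_integrable (u n)"
    and fast: "\<And>n. norm (abs_L2 (u (Suc n)) - abs_L2 (u n)) \<le> (1 / 4) ^ n"
  shows "AE x in lebesgue. convergent (\<lambda>n. u n x)"
proof -
  have [measurable]: "u n \<in> borel_measurable lebesgue" for n
    using u by (rule square_integrable_measurable)
  \<comment> \<open>The squared norms decay like \<open>(1 / 16) ^ n\<close>. The weight
    \<open>4 ^ n\<close> leaves a summable \<open>(1 / 4) ^ n\<close> for the integrals and still
    yields pointwise decay of order \<open>(1 / 2) ^ n\<close>.\<close>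
  define d where "d n x = 4 ^ n * (cmod (u (Suc n) x - u n x))\<^sup>2" for n x
  have "(\<integral>\<^sup>+x. (\<Sum>n. ennreal (d n x)) \<partial>lebesgue) = (\<Sum>n. \<integral>\<^sup>+x. ennreal (d n x) \<partial>lebesgue)"
    unfolding d_def by (rule nn_integral_suminf) measurable
  also have "\<dots> \<le> (\<Sum>n. ennreal ((1 / 4) ^ n))"
  proof (intro suminf_le)
    fix n
    have "(\<integral>\<^sup>+x. ennreal (d n x) \<partial>lebesgue) =
        ennreal (4 ^ n) * (\<integral>\<^sup>+x. ennreal ((cmod (u (Suc n) x - u n x))\<^sup>2) \<partial>lebesgue)"
      unfolding d_def by (subst nn_integral_cmult [symmetric]) (auto simp: ennreal_mult)
    also have "\<dots> = ennreal (4 ^ n * (norm (abs_L2 (u (Suc n)) - abs_L2 (u n)))\<^sup>2)"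
      using u by (simp add: nn_integral_square_abs_L2 square_integrable_diff diff_abs_L2 ennreal_mult)
    also have "\<dots> \<le> ennreal (4 ^ n * ((1 / 4) ^ n)\<^sup>2)"
      using fast[of n] by (intro ennreal_leI mult_left_mono power_mono) auto
    also have "4 ^ n * ((1 / 4) ^ n)\<^sup>2 = ((1 / 4) ^ n :: real)"
      by (simp add: power2_eq_square power_one_over)
    finally show "(\<integral>\<^sup>+x. ennreal (d n x) \<partial>lebesgue) \<le> ennreal ((1 / 4) ^ n)" .
  qed auto
  also have "\<dots> < \<infinity>"
    using summable_geometric[of "1 / 4 :: real"] by (subst suminf_ennreal2) auto
  finally have "(\<integral>\<^sup>+x. (\<Sum>n. ennreal (d n x)) \<partial>lebesgue) \<noteq> \<infinity>"
    by simp
  then have "AE x in lebesgue. (\<Sum>n. ennreal (d n x)) \<noteq> \<infinity>"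
    by (intro nn_integral_noteq_infinite) (auto simp: d_def)
  then show ?thesis
  proof eventually_elim
    case (elim x)
    then have "summable (\<lambda>n. d n x)"
      by (intro summable_suminf_not_top) (auto simp: d_def)
    \<comment> \<open>A mere bound \<open>K\<close> on the weighted terms is enough: dividing by
      \<open>4 ^ n\<close> and taking roots gives the geometric majorant.\<close>
    then have "Bseq (\<lambda>n. d n x)"
      by (intro convergent_imp_Bseq summable_LIMSEQ_zero[THEN convergentI])
    then obtain K where K: "K > 0" "\<And>n. d n x \<le> K"
      by (auto simp: Bseq_def d_def)
    have bound: "cmod (u (Suc n) x - u n x) \<le> sqrt K * (1 / 2) ^ n" for n
    proof (rule power2_le_imp_le)
      have "(4::real) ^ n = (2 ^ n)\<^sup>2"
        by (simp add: power2_eq_square flip: power_mult_distrib)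
      then show "(cmod (u (Suc n) x - u n x))\<^sup>2 \<le> (sqrt K * (1 / 2) ^ n)\<^sup>2"
        using K(1) K(2)[of n] by (simp add: d_def power_mult_distrib power_divide field_simps)
    qed (use K(1) in simp)
    have "summable (\<lambda>n. u (Suc n) x - u n x)"
    proof (rule summable_comparison_test')
      show "summable (\<lambda>n. sqrt K * (1 / 2) ^ n)"
        by (intro summable_mult summable_geometric) simp
      show "norm (u (Suc n) x - u n x) \<le> sqrt K * (1 / 2) ^ n" for n
        by (rule bound)
    qed
    then have "convergent (\<lambda>n. u 0 x + (\<Sum>i<n. u (Suc i) x - u i x))"
      by (intro convergent_add convergent_const) (simp add: summable_iff_convergent)
    moreover have "u 0 x + (\<Sum>i<n. u (Suc i) x - u i x) = u n x" for n
      using sum_lessThan_telescope[of "\<lambda>i. u i x" n] by simp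
    ultimately show ?case
      by (simp only:)
  qed
qed

lemma Cauchy_fast_indices:
  fixes X :: "nat \<Rightarrow> 'a::metric_space"
  assumes "Cauchy X" and e: "\<And>n. e n > 0"
  obtains r :: "nat \<Rightarrow> nat" where "\<And>n. n \<le> r n" "\<And>n. dist (X (r (Suc n))) (X (r n)) < e n"
proof -
  have "\<exists>M. \<forall>i\<ge>M. \<forall>j\<ge>M. dist (X i) (X j) < e n" for n
    using assms by (auto simp: Cauchy_def)
  then obtain M where M: "\<And>n i j. i \<ge> M n \<Longrightarrow> j \<ge> M n \<Longrightarrow> dist (X i) (X j) < e n"
    by metis
  \<comment> \<open>The sum dominates \<open>M n\<close> and makes \<open>r\<close> monotone; the
    summand \<open>n\<close> ensures \<open>n \<le> r n\<close>.\<close>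
  define r where "r n = n + (\<Sum>i\<le>n. M i)" for n
  have "M n \<le> r n" for n
    unfolding r_def by (rule trans_le_add2, rule member_le_sum) auto
  moreover have "r n \<le> r (Suc n)" for n
    by (simp add: r_def)
  ultimately have "dist (X (r (Suc n))) (X (r n)) < e n" for n
    by (intro M) (auto intro: order_trans)
  moreover have "n \<le> r n" for n
    by (simp add: r_def)
  ultimately show thesis
    using that by blast
qed

text \<open>Riesz-Fischer: the limit is taken pointwise along a fast subsequence, and Fatou's lemma
  shows that the whole sequence converges to it in norm.\<close>

instance L2 :: (euclidean_space) banach
proof
  fix X :: "nat \<Rightarrow> 'a L2"
  assume X: "Cauchy X"
  have "\<exists>f. square_integrable f \<and> X n = abs_L2 f" for n
    by (metis L2_cases)
  then obtain u where u: "\<And>n. square_integrable (u n)" and Xu: "\<And>n. X n = abs_L2 (u n)"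
    by metis
  have [measurable]: "u n \<in> borel_measurable lebesgue" for n
    using u by (rule square_integrable_measurable)
  obtain r where r: "\<And>n. n \<le> r n" and fast: "\<And>n. dist (X (r (Suc n))) (X (r n)) < (1 / 4) ^ n"
    using Cauchy_fast_indices[OF X, of "\<lambda>n. (1 / 4) ^ n"] by auto
  \<comment> \<open>Where the subsequence diverges, \<open>lim\<close> is an unspecified value; this
    concerns a null set only.\<close>
  define f where "f x = lim (\<lambda>n. u (r n) x)" for x
  have [measurable]: "f \<in> borel_measurable lebesgue"
    unfolding f_def by measurable
  have "AE x in lebesgue. convergent (\<lambda>n. u (r n) x)"
    using fast u by (intro AE_convergent_of_fast_Cauchy) (auto simp: dist_norm Xu intro: less_imp_le)
  then have lim: "AE x in lebesgue. (\<lambda>n. u (r n) x) \<longlonglongrightarrow> f x"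
    by eventually_elim (simp add: f_def convergent_LIMSEQ_iff)
  \<comment> \<open>Fatou in the subsequence index \<open>k\<close>, with \<open>n\<close> fixed:
    eventually \<open>r k \<ge> k \<ge> N\<close>, so the Cauchy bound survives the limit and
    already speaks of the original index \<open>n\<close>.\<close>
  have close: "(\<integral>\<^sup>+x. ennreal ((cmod (f x - u n x))\<^sup>2) \<partial>lebesgue) \<le> ennreal (e\<^sup>2)"
    if "e > 0" and N: "\<And>k. k \<ge> N \<Longrightarrow> norm (X k - X n) \<le> e" for e N n
  proof -
    have "(\<integral>\<^sup>+x. ennreal ((cmod (f x - u n x))\<^sup>2) \<partial>lebesgue) =
        (\<integral>\<^sup>+x. liminf (\<lambda>k. ennreal ((cmod (u (r k) x - u n x))\<^sup>2)) \<partial>lebesgue)"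
    proof (rule nn_integral_cong_AE, use lim in eventually_elim)
      case (elim x)
      then have "(\<lambda>k. ennreal ((cmod (u (r k) x - u n x))\<^sup>2)) \<longlonglongrightarrow> ennreal ((cmod (f x - u n x))\<^sup>2)"
        by (intro tendsto_intros)
      then show ?case
        by (intro lim_imp_Liminf [symmetric]) auto
    qed
    also have "\<dots> \<le> liminf (\<lambda>k. \<integral>\<^sup>+x. ennreal ((cmod (u (r k) x - u n x))\<^sup>2) \<partial>lebesgue)"
      by (rule nn_integral_liminf) measurable
    also have "\<dots> \<le> limsup (\<lambda>k. \<integral>\<^sup>+x. ennreal ((cmod (u (r k) x - u n x))\<^sup>2) \<partial>lebesgue)"
      by (rule Liminf_le_Limsup) simp
    also have "\<dots> \<le> ennreal (e\<^sup>2)"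
    proof (rule Limsup_bounded)
      show "\<forall>\<^sub>F k in sequentially. (\<integral>\<^sup>+x. ennreal ((cmod (u (r k) x - u n x))\<^sup>2) \<partial>lebesgue) \<le> ennreal (e\<^sup>2)"
        using eventually_ge_at_top[of N]
      proof eventually_elim
        case (elim k)
        have "(\<integral>\<^sup>+x. ennreal ((cmod (u (r k) x - u n x))\<^sup>2) \<partial>lebesgue) = ennreal ((norm (X (r k) - X n))\<^sup>2)"
          using u by (simp add: Xu diff_abs_L2 nn_integral_square_abs_L2 square_integrable_diff)
        also have "\<dots> \<le> ennreal (e\<^sup>2)"
          using elim r[of k] by (intro ennreal_leI power_mono N) auto
        finally show ?case .
      qed
    qed
    finally show ?thesis .
  qed
  have Cauchy: "\<exists>N. \<forall>k\<ge>N. \<forall>n\<ge>N. norm (X k - X n) \<le> e" if "e > 0" for e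
    using X that unfolding Cauchy_def dist_norm by (meson less_imp_le)
  obtain N where N: "\<And>k n. k \<ge> N \<Longrightarrow> n \<ge> N \<Longrightarrow> norm (X k - X n) \<le> 1"
    using Cauchy[of 1] by auto
  \<comment> \<open>Finite distance from one member \<open>u N\<close> puts \<open>f\<close> itself
    into the space.\<close>
  have "square_integrable (\<lambda>x. f x - u N x)"
    unfolding square_integrable_iff_nn_integral
    using close[of 1 N N] N by (auto intro: le_less_trans)
  from square_integrable_add[OF this u[of N]] have f: "square_integrable f"
    by simp
  have "X \<longlonglongrightarrow> abs_L2 f"
  proof (rule metric_LIMSEQ_I)
    fix e :: real assume "e > 0"
    then obtain N where N: "\<And>k n. k \<ge> N \<Longrightarrow> n \<ge> N \<Longrightarrow> norm (X k - X n) \<le> e / 2"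
      using Cauchy[of "e / 2"] by auto
    have "dist (X n) (abs_L2 f) < e" if "n \<ge> N" for n
    proof -
      have "ennreal ((norm (abs_L2 f - X n))\<^sup>2) \<le> ennreal ((e / 2)\<^sup>2)"
        using close[of "e / 2" N n] N that \<open>e > 0\<close> f u
        by (simp add: Xu diff_abs_L2 nn_integral_square_abs_L2 square_integrable_diff)
      then have "norm (abs_L2 f - X n) \<le> e / 2"
        using \<open>e > 0\<close> by (simp add: ennreal_le_iff power2_le_iff_abs_le)
      then show ?thesis
        using \<open>e > 0\<close> by (simp add: dist_norm norm_minus_commute)
    qed
    then show "\<exists>N. \<forall>n\<ge>N. dist (X n) (abs_L2 f) < e"
      by blast
  qed
  then show "convergent X"
    by (rule convergentI)
qed

section \<open>Hermite coefficients\<close>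

text \<open>Domination by the sum of the squared moduli.\<close>

lemma integrable_square_integrable_mult:
  assumes "square_integrable f" "square_integrable g"
  shows "integrable lebesgue (\<lambda>x. f x * g x)"
proof (rule Bochner_Integration.integrable_bound)
  have [measurable]: "f \<in> borel_measurable lebesgue" "g \<in> borel_measurable lebesgue"
    using assms by (auto dest: square_integrable_measurable)
  show "integrable lebesgue (\<lambda>x. (cmod (f x))\<^sup>2 + (cmod (g x))\<^sup>2)"
    using assms by (auto simp: square_integrable_def)
  show "(\<lambda>x. f x * g x) \<in> borel_measurable lebesgue"
    by measurable
  have "a * b \<le> a\<^sup>2 + b\<^sup>2" if "a \<ge> 0" "b \<ge> 0" for a b :: real
    using sum_squares_bound[of a b] mult_nonneg_nonneg[OF that] by linarith
  then show "AE x in lebesgue. norm (f x * g x) \<le> norm ((cmod (f x))\<^sup>2 + (cmod (g x))\<^sup>2)"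
    by (simp add: norm_mult)
qed

lemma hermite_coeff_add: "hermite_coeff (f + g) \<nu> = hermite_coeff f \<nu> + hermite_coeff g \<nu>"
proof (transfer, goal_cases)
  case (1 f g)
  then show ?case
    by (simp add: distrib_right integrable_square_integrable_mult square_integrable_hermite_fun_vec fun_eq_iff)
qed

lemma hermite_coeff_cscale: "hermite_coeff (cscale c f) \<nu> = c * hermite_coeff f \<nu>"
  by transfer (simp add: mult.assoc fun_eq_iff)

section \<open>Complex scalar multiplication on the quotient\<close>

lemma cscale_add_right: "cscale c (f + g) = cscale c f + cscale c g"
  by (transfer; elim conjE; intro conjI square_integrable_add square_integrable_mult;
      (assumption | simp add: algebra_simps))

lemma cscale_add_left: "cscale (a + b) f = cscale a f + cscale b f"
  by (transfer; elim conjE; intro conjI square_integrable_add square_integrable_mult;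
      (assumption | simp add: algebra_simps))

lemma cscale_cscale: "cscale a (cscale b f) = cscale (a * b) f"
  by (transfer; elim conjE; intro conjI square_integrable_add square_integrable_mult;
      (assumption | simp add: algebra_simps))

lemma cscale_zero_left [simp]: "cscale 0 f = 0"
  by (metis norm_L2_cscale norm_zero mult_zero_left norm_L2_zero_iff)

lemma cscale_one [simp]: "cscale 1 f = f"
  by (metis scaleR_L2_def scaleR_one of_real_1)

lemma cscale_minus_left: "cscale (- c) f = - cscale c f"
  by (simp add: uminus_L2_def cscale_cscale)

lemma bounded_linear_cscale_right: "bounded_linear (cscale c)"
  by (rule bounded_linear_intro[where K = "cmod c"])
    (simp_all add: cscale_add_right scaleR_L2_def cscale_cscale mult.commute norm_L2_cscale)

lemma bounded_linear_cscale_left: "bounded_linear (\<lambda>c. cscale c f)"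
  by (rule bounded_linear_intro[where K = "norm f"])
    (simp_all add: cscale_add_left scaleR_L2_def cscale_cscale scaleR_conv_of_real norm_L2_cscale)

lemma hermite_coeff_sum: "finite F \<Longrightarrow> hermite_coeff (\<Sum>i\<in>F. g i) \<nu> = (\<Sum>i\<in>F. hermite_coeff (g i) \<nu>)"
proof (induction F rule: finite_induct)
  case empty
  show ?case using hermite_coeff_cscale[of 0 0 \<nu>] by simp
qed (simp add: hermite_coeff_add)

lemma hermite_coeff_hermite_L2: "hermite_coeff (hermite_L2 \<mu>) \<nu> = (if \<mu> = \<nu> then 1 else 0)"
  by (simp add: hermite_coeff.abs_eq hermite_L2.abs_eq square_integrable_hermite_fun_vec
      hermite_fun_vec_orthonormal)

text \<open>The expansion of a squared norm around a unit vector. As Hermite functions are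
  real-valued, the coefficient, defined without conjugation, is the inner product. Pythagoras and
  Bessel both follow from this by induction.\<close>

lemma norm_add_hermite_L2:
  fixes f :: "(real ^ 'n) L2"
  shows "(norm (f + cscale a (hermite_L2 \<nu>)))\<^sup>2 =
    (norm f)\<^sup>2 + 2 * Re (cnj a * hermite_coeff f \<nu>) + (cmod a)\<^sup>2"
proof (transfer fixing: a, goal_cases)
  case (1 f \<nu>)
  define h where "h = hermite_fun_vec \<nu>"
  have f: "square_integrable f"
    using 1 by simp
  have h: "square_integrable h"
    unfolding h_def by (rule square_integrable_hermite_fun_vec)
  have fh: "integrable lebesgue (\<lambda>x. f x * h x)"
    using f h by (rule integrable_square_integrable_mult)
  have hreal: "h x = of_real (Re (h x))" for x
    by (simp add: h_def hermite_fun_vec_def complex_eq_iff)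
  \<comment> \<open>For real-valued \<open>h\<close> the squared modulus is
    \<open>h x * h x\<close>, so orthonormality gives norm one.\<close>
  have "complex_of_real (\<integral>x. (cmod (h x))\<^sup>2 \<partial>lebesgue) = (\<integral>x. h x * h x \<partial>lebesgue)"
    unfolding integral_complex_of_real [symmetric]
    by (rule Bochner_Integration.integral_cong)
      (use hreal in \<open>auto simp: complex_eq_iff cmod_power2 simp flip: power2_eq_square\<close>)
  then have norm_h: "(\<integral>x. (cmod (h x))\<^sup>2 \<partial>lebesgue) = 1"
    unfolding h_def hermite_fun_vec_orthonormal by (simp only: simp_thms if_True of_real_eq_1_iff)
  have pt: "(cmod (f x + a * h x))\<^sup>2 =
      (cmod (f x))\<^sup>2 + 2 * Re (cnj a * (f x * h x)) + (cmod a)\<^sup>2 * (cmod (h x))\<^sup>2" for x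
    using arg_cong[OF hreal[of x], of Im]
    unfolding cmod_power2 by (simp add: power2_eq_square algebra_simps)
  have "(\<integral>x. (cmod (f x + a * h x))\<^sup>2 \<partial>lebesgue) = (\<integral>x. (cmod (f x))\<^sup>2 \<partial>lebesgue) +
      2 * (\<integral>x. Re (cnj a * (f x * h x)) \<partial>lebesgue) + (cmod a)\<^sup>2 * (\<integral>x. (cmod (h x))\<^sup>2 \<partial>lebesgue)"
    unfolding pt using f h fh
    by (simp add: square_integrable_def del: times_complex.sel)
  also have "(\<integral>x. Re (cnj a * (f x * h x)) \<partial>lebesgue) = Re (cnj a * (\<integral>x. f x * h x \<partial>lebesgue))"
    using fh by (subst integral_Re) (simp_all del: times_complex.sel)
  finally have eq: "(\<integral>x. (cmod (f x + a * h x))\<^sup>2 \<partial>lebesgue) = (\<integral>x. (cmod (f x))\<^sup>2 \<partial>lebesgue) +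
      2 * Re (cnj a * (\<integral>x. f x * h x \<partial>lebesgue)) + (cmod a)\<^sup>2"
    by (simp only: norm_h mult_1_right)
  have sqrt_sq: "(sqrt (\<integral>x. (cmod (g x))\<^sup>2 \<partial>lebesgue))\<^sup>2 = (\<integral>x. (cmod (g x))\<^sup>2 \<partial>lebesgue)"
    for g :: "real ^ 'n \<Rightarrow> complex"
    by simp
  show ?case
    unfolding sqrt_sq by (rule eq[unfolded h_def])
qed

text \<open>Pythagoras: the partial sum has coefficient 0 at each new index, so the cross term
  vanishes.\<close>

lemma norm_sum_hermite_L2:
  assumes "finite F"
  shows "(norm (\<Sum>\<nu>\<in>F. cscale (a \<nu>) (hermite_L2 \<nu>)))\<^sup>2 = (\<Sum>\<nu>\<in>F. (cmod (a \<nu>))\<^sup>2)"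
  using assms
proof (induction F rule: finite_induct)
  case (insert \<mu> F)
  have "hermite_coeff (\<Sum>\<nu>\<in>F. cscale (a \<nu>) (hermite_L2 \<nu>)) \<mu> = 0"
    using insert.hyps
    by (auto simp: hermite_coeff_sum hermite_coeff_cscale hermite_coeff_hermite_L2 intro!: sum.neutral)
  then show ?case
    using insert norm_add_hermite_L2[of "\<Sum>\<nu>\<in>F. cscale (a \<nu>) (hermite_L2 \<nu>)" "a \<mu>" \<mu>]
    by (simp add: add.commute)
qed simp

text \<open>Removing a new component leaves the earlier ones alone: the remainder still has the
  coefficient of \<open>f\<close> at the new index, and the cross term, minus twice its squared
  modulus, combines with the quadratic term to minus once.\<close>

lemma norm_diff_hermite_sum:
  assumes "finite F"
  shows "(norm (f - (\<Sum>\<nu>\<in>F. cscale (hermite_coeff f \<nu>) (hermite_L2 \<nu>))))\<^sup>2 =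
    (norm f)\<^sup>2 - (\<Sum>\<nu>\<in>F. (cmod (hermite_coeff f \<nu>))\<^sup>2)"
  using assms
proof (induction F rule: finite_induct)
  case (insert \<mu> F)
  define g where "g = f - (\<Sum>\<nu>\<in>F. cscale (hermite_coeff f \<nu>) (hermite_L2 \<nu>))"
  have "hermite_coeff (\<Sum>\<nu>\<in>F. cscale (hermite_coeff f \<nu>) (hermite_L2 \<nu>)) \<mu> = 0"
    using insert.hyps
    by (auto simp: hermite_coeff_sum hermite_coeff_cscale hermite_coeff_hermite_L2 intro!: sum.neutral)
  then have g: "hermite_coeff g \<mu> = hermite_coeff f \<mu>"
    using hermite_coeff_add[of g "\<Sum>\<nu>\<in>F. cscale (hermite_coeff f \<nu>) (hermite_L2 \<nu>)" \<mu>]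
    by (simp add: g_def)
  have eq: "f - (\<Sum>\<nu>\<in>insert \<mu> F. cscale (hermite_coeff f \<nu>) (hermite_L2 \<nu>)) =
      g + cscale (- hermite_coeff f \<mu>) (hermite_L2 \<mu>)"
    using insert.hyps by (simp add: g_def cscale_minus_left)
  have "Re (cnj (- hermite_coeff f \<mu>) * hermite_coeff f \<mu>) = - (cmod (hermite_coeff f \<mu>))\<^sup>2"
    by (simp add: cmod_power2 flip: power2_eq_square)
  then have "(norm (g + cscale (- hermite_coeff f \<mu>) (hermite_L2 \<mu>)))\<^sup>2 =
      (norm g)\<^sup>2 - (cmod (hermite_coeff f \<mu>))\<^sup>2"
    unfolding norm_add_hermite_L2 g by simp
  with insert show ?case
    unfolding eq by (simp add: g_def)
qed simp

lemma hermite_bessel: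
  assumes "finite F"
  shows "(\<Sum>\<nu>\<in>F. (cmod (hermite_coeff f \<nu>))\<^sup>2) \<le> (norm f)\<^sup>2"
  using norm_diff_hermite_sum[OF assms, of f]
    zero_le_power2[of "norm (f - (\<Sum>\<nu>\<in>F. cscale (hermite_coeff f \<nu>) (hermite_L2 \<nu>)))"] by linarith

lemma cmod_hermite_coeff_le: "cmod (hermite_coeff f \<nu>) \<le> norm f"
  using hermite_bessel[of "{\<nu>}" f] by (simp add: power2_le_iff_abs_le)

text \<open>Pythagoras, the bound on \<open>m\<close> term by term, then Bessel.\<close>

lemma norm_sum_hermite_term_le:
  assumes "finite F" "e \<ge> 0" "\<And>\<nu>. \<nu> \<in> F \<Longrightarrow> cmod (m \<nu>) \<le> e"
  shows "norm (\<Sum>\<nu>\<in>F. hermite_term m f \<nu>) \<le> e * norm f"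
proof (rule power2_le_imp_le)
  have "(norm (\<Sum>\<nu>\<in>F. hermite_term m f \<nu>))\<^sup>2 = (\<Sum>\<nu>\<in>F. (cmod (m \<nu>))\<^sup>2 * (cmod (hermite_coeff f \<nu>))\<^sup>2)"
    unfolding hermite_term_def norm_sum_hermite_L2[OF assms(1)] by (simp add: norm_mult power_mult_distrib)
  also have "\<dots> \<le> (\<Sum>\<nu>\<in>F. e\<^sup>2 * (cmod (hermite_coeff f \<nu>))\<^sup>2)"
    using assms by (intro sum_mono mult_right_mono power_mono) auto
  also have "\<dots> \<le> e\<^sup>2 * (norm f)\<^sup>2"
    unfolding sum_distrib_left [symmetric] using assms(1) by (intro mult_left_mono hermite_bessel) auto
  finally show "(norm (\<Sum>\<nu>\<in>F. hermite_term m f \<nu>))\<^sup>2 \<le> (e * norm f)\<^sup>2"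
    by (simp add: power_mult_distrib)
qed (use assms in simp)

text \<open>The finite bound passes to the limit: once \<open>G\<close> contains \<open>F\<close>,
  the two sums differ by the sum over \<open>G - F\<close>. Summability makes \<open>infsum\<close>
  a genuine limit and not its default 0.\<close>

lemma norm_hermite_multiplier_diff_le:
  assumes "hermite_term m f summable_on UNIV"
    and F: "finite F" "e \<ge> 0" "\<And>\<nu>. \<nu> \<notin> F \<Longrightarrow> cmod (m \<nu>) \<le> e"
  shows "norm (hermite_multiplier m f - (\<Sum>\<nu>\<in>F. hermite_term m f \<nu>)) \<le> e * norm f"
proof (rule tendsto_upperbound)
  have "(sum (hermite_term m f) \<longlongrightarrow> hermite_multiplier m f) (finite_subsets_at_top UNIV)"
    using has_sum_infsum[OF assms(1)] by (simp add: has_sum_def hermite_multiplier_def)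
  then show "((\<lambda>G. norm (sum (hermite_term m f) G - (\<Sum>\<nu>\<in>F. hermite_term m f \<nu>))) \<longlongrightarrow>
      norm (hermite_multiplier m f - (\<Sum>\<nu>\<in>F. hermite_term m f \<nu>))) (finite_subsets_at_top UNIV)"
    by (intro tendsto_intros)
  have "\<forall>\<^sub>F G in finite_subsets_at_top UNIV. finite G \<and> F \<subseteq> G"
    using F(1) by (auto simp: eventually_finite_subsets_at_top)
  then show "\<forall>\<^sub>F G in finite_subsets_at_top UNIV.
      norm (sum (hermite_term m f) G - (\<Sum>\<nu>\<in>F. hermite_term m f \<nu>)) \<le> e * norm f"
  proof eventually_elim
    case (elim G)
    then have "sum (hermite_term m f) G - (\<Sum>\<nu>\<in>F. hermite_term m f \<nu>) = sum (hermite_term m f) (G - F)"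
      by (simp add: sum_diff)
    then show ?case
      using elim F norm_sum_hermite_term_le[of "G - F" e m f] by simp
  qed
qed simp

section \<open>Compactness\<close>

text \<open>One compact set serves all coefficient families bounded by \<open>R\<close>: each new
  index adds the continuous image of a disc, and sums of two compact sets are compact.\<close>

lemma compact_hermite_span:
  fixes F :: "(nat ^ 'n) set"
  assumes "finite F"
  shows "\<exists>K. compact K \<and> (\<forall>a. (\<forall>\<nu>\<in>F. cmod (a \<nu>) \<le> R) \<longrightarrow> (\<Sum>\<nu>\<in>F. cscale (a \<nu>) (hermite_L2 \<nu>)) \<in> K)"
  using assms
proof (induction F rule: finite_induct)
  case empty
  show ?case by (intro exI[of _ "{0}"]) simp
next
  case (insert \<mu> F)
  then obtain K where K: "compact K"
    "\<And>a. \<forall>\<nu>\<in>F. cmod (a \<nu>) \<le> R \<Longrightarrow> (\<Sum>\<nu>\<in>F. cscale (a \<nu>) (hermite_L2 \<nu>)) \<in> K"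
    by blast
  define D where "D = (\<lambda>c. cscale c (hermite_L2 \<mu>)) ` cball 0 R"
  have "compact D"
    unfolding D_def
    by (intro compact_continuous_image linear_continuous_on[OF bounded_linear_cscale_left]
        compact_cball)
  then have "compact {x + y |x y. x \<in> D \<and> y \<in> K}"
    using K(1) by (rule compact_sums)
  moreover have "(\<Sum>\<nu>\<in>insert \<mu> F. cscale (a \<nu>) (hermite_L2 \<nu>)) \<in> {x + y |x y. x \<in> D \<and> y \<in> K}"
    if "\<forall>\<nu>\<in>insert \<mu> F. cmod (a \<nu>) \<le> R" for a
    using that K(2)[of a] insert.hyps by (auto simp: D_def intro!: exI)
  ultimately show ?case
    by blast
qed

text \<open>Three steps of \<open>e / 3\<close> lead from a point of the closure to
  \<open>S\<close>, on to \<open>K\<close>, and then to a finite net of \<open>K\<close>; so the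
  closure is totally bounded, and it is complete.\<close>

lemma compact_closure_if_approximable:
  fixes S :: "'a::complete_space set"
  assumes "\<And>e. e > 0 \<Longrightarrow> \<exists>K. compact K \<and> (\<forall>x\<in>S. \<exists>y\<in>K. dist x y < e)"
  shows "compact (closure S)"
  unfolding compact_eq_totally_bounded
proof (intro conjI allI impI)
  show "complete (closure S)"
    by (simp add: complete_eq_closed)
  fix e :: real assume "e > 0"
  then obtain K where K: "compact K" "\<And>x. x \<in> S \<Longrightarrow> \<exists>y\<in>K. dist x y < e / 3"
    using assms[of "e / 3"] by auto
  obtain C where C: "finite C" "K \<subseteq> (\<Union>c\<in>C. ball c (e / 3))"
    using K(1) \<open>e > 0\<close> unfolding compact_eq_totally_bounded by (metis zero_less_divide_iff zero_less_numeral)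
  have "closure S \<subseteq> (\<Union>c\<in>C. ball c e)"
  proof
    fix z assume "z \<in> closure S"
    then obtain x where "x \<in> S" "dist x z < e / 3"
      using \<open>e > 0\<close> closure_approachable[of z S] by (metis zero_less_divide_iff zero_less_numeral)
    moreover from K(2)[OF \<open>x \<in> S\<close>] obtain y where "y \<in> K" "dist x y < e / 3"
      by blast
    moreover from \<open>y \<in> K\<close> C(2) obtain c where "c \<in> C" "dist c y < e / 3"
      by auto
    ultimately have "dist c z < e"
      using dist_triangle[of c z y] dist_triangle[of y z x] by (simp add: dist_commute)
    with \<open>c \<in> C\<close> show "z \<in> (\<Union>c\<in>C. ball c e)"
      by auto
  qed
  with C(1) show "\<exists>C. finite C \<and> closure S \<subseteq> (\<Union>c\<in>C. ball c e)"
    by blast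
qed

section \<open>Multi-indices tending to infinity\<close>

lemma finite_multi_index_abs_less: "finite {\<nu> :: nat ^ 'n. multi_index_abs \<nu> < N}"
proof (rule finite_subset)
  show "{\<nu> :: nat ^ 'n. multi_index_abs \<nu> < N} \<subseteq> {\<nu>. \<forall>i. \<nu> $ i \<in> {..N}}"
  proof (intro subsetI CollectI allI)
    fix \<nu> :: "nat ^ 'n" and i
    assume "\<nu> \<in> {\<nu>. multi_index_abs \<nu> < N}"
    moreover have "\<nu> $ i \<le> multi_index_abs \<nu>"
      unfolding multi_index_abs_def by (rule member_le_sum) auto
    ultimately show "\<nu> $ i \<in> {..N}"
      by simp
  qed
  have "vec_nth ` {\<nu> :: nat ^ 'n. \<forall>i. \<nu> $ i \<in> {..N}} \<subseteq> UNIV \<rightarrow>\<^sub>E {..N}"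
    by auto
  then have "finite (vec_nth ` {\<nu> :: nat ^ 'n. \<forall>i. \<nu> $ i \<in> {..N}})"
    by (rule finite_subset) (simp add: finite_PiE)
  then show "finite {\<nu> :: nat ^ 'n. \<forall>i. \<nu> $ i \<in> {..N}}"
    by (rule finite_imageD) (simp add: inj_on_def vec_nth_inject)
qed

text \<open>Gives the limit the form used in both directions of the theorem. Only finitely many
  indices have bounded degree, and a finite set of indices has bounded degree.\<close>

lemma tendsto_multi_index_abs_iff:
  fixes m :: "nat ^ 'n \<Rightarrow> complex"
  shows "(m \<longlongrightarrow> 0) (filtercomap multi_index_abs at_top) \<longleftrightarrow> (\<forall>e>0. finite {\<nu>. e \<le> cmod (m \<nu>)})"
proof (intro iffI allI impI)
  fix e :: real
  assume "(m \<longlongrightarrow> 0) (filtercomap multi_index_abs at_top)" "e > 0"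
  then have "\<forall>\<^sub>F \<nu> in filtercomap multi_index_abs at_top. cmod (m \<nu>) < e"
    by (auto dest: tendstoD simp: dist_norm)
  then obtain N where "\<And>\<nu>. multi_index_abs \<nu> \<ge> N \<Longrightarrow> cmod (m \<nu>) < e"
    by (auto simp: eventually_filtercomap_at_top_linorder)
  then have "{\<nu>. e \<le> cmod (m \<nu>)} \<subseteq> {\<nu>. multi_index_abs \<nu> < N}"
    by (auto simp flip: not_le)
  then show "finite {\<nu>. e \<le> cmod (m \<nu>)}"
    using finite_multi_index_abs_less by (rule finite_subset)
next
  assume *: "\<forall>e>0. finite {\<nu>. e \<le> cmod (m \<nu>)}"
  show "(m \<longlongrightarrow> 0) (filtercomap multi_index_abs at_top)"
  proof (rule tendstoI)
    fix e :: real assume "e > 0"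
    \<comment> \<open>The sum of all exceptional degrees bounds each one; \<open>Suc\<close> makes
      the bound strict.\<close>
    define N where "N = Suc (\<Sum>\<nu>\<in>{\<nu>. e \<le> cmod (m \<nu>)}. multi_index_abs \<nu>)"
    have "cmod (m \<nu>) < e" if "N \<le> multi_index_abs \<nu>" for \<nu>
    proof (rule ccontr)
      assume "\<not> cmod (m \<nu>) < e"
      then have "multi_index_abs \<nu> \<le> (\<Sum>\<nu>\<in>{\<nu>. e \<le> cmod (m \<nu>)}. multi_index_abs \<nu>)"
        using * \<open>e > 0\<close> by (intro member_le_sum) auto
      with that show False
        by (simp add: N_def)
    qed
    then show "\<forall>\<^sub>F \<nu> in filtercomap multi_index_abs at_top. dist (m \<nu>) 0 < e"
      by (auto simp: eventually_filtercomap_at_top_linorder)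
  qed
qed

section \<open>Linearity and eigenvectors of the multiplier\<close>

lemma hermite_multiplier_add:
  assumes "hermite_term m f summable_on UNIV" "hermite_term m g summable_on UNIV"
  shows "hermite_multiplier m (f + g) = hermite_multiplier m f + hermite_multiplier m g"
proof -
  have "hermite_term m (f + g) = (\<lambda>\<nu>. hermite_term m f \<nu> + hermite_term m g \<nu>)"
    by (simp add: hermite_term_def hermite_coeff_add distrib_left cscale_add_left fun_eq_iff)
  then show ?thesis
    unfolding hermite_multiplier_def using assms by (simp add: infsum_add)
qed

lemma hermite_multiplier_cscale:
  assumes "hermite_term m f summable_on UNIV"
  shows "hermite_multiplier m (cscale c f) = cscale c (hermite_multiplier m f)"
proof -
  have "hermite_term m (cscale c f) = (\<lambda>\<nu>. cscale c (hermite_term m f \<nu>))"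
    by (simp add: hermite_term_def hermite_coeff_cscale cscale_cscale mult_ac fun_eq_iff)
  moreover have "((\<lambda>\<nu>. cscale c (hermite_term m f \<nu>)) has_sum cscale c (hermite_multiplier m f)) UNIV"
    unfolding hermite_multiplier_def using assms
    by (intro has_sum_bounded_linear[OF bounded_linear_cscale_right] has_sum_infsum)
  ultimately show ?thesis
    unfolding hermite_multiplier_def by (metis infsumI)
qed

text \<open>Orthonormality kills every term except the one at \<nu>.\<close>

lemma hermite_multiplier_hermite_L2: "hermite_multiplier m (hermite_L2 \<nu>) = cscale (m \<nu>) (hermite_L2 \<nu>)"
proof -
  have "hermite_multiplier m (hermite_L2 \<nu>) = infsum (hermite_term m (hermite_L2 \<nu>)) {\<nu>}"
    unfolding hermite_multiplier_def
    by (rule infsum_cong_neutral) (auto simp: hermite_term_def hermite_coeff_hermite_L2)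
  then show ?thesis
    by (simp add: hermite_term_def hermite_coeff_hermite_L2)
qed

lemma norm_hermite_L2 [simp]: "norm (hermite_L2 \<nu>) = 1"
  using norm_sum_hermite_L2[of "{\<nu>}" "\<lambda>_. 1"] by (simp add: power2_eq_1_iff)
    (smt (verit) norm_ge_zero)

text \<open>The difference has coefficient \<open>a\<close> at \<mu>, and a coefficient never
  exceeds the norm.\<close>

lemma dist_cscale_hermite_L2:
  assumes "\<mu> \<noteq> \<nu>"
  shows "cmod a \<le> dist (cscale a (hermite_L2 \<mu>)) (cscale b (hermite_L2 \<nu>))"
proof -
  have "hermite_coeff (cscale a (hermite_L2 \<mu>) - cscale b (hermite_L2 \<nu>)) \<mu> =
      hermite_coeff (cscale a (hermite_L2 \<mu>) + cscale (- b) (hermite_L2 \<nu>)) \<mu>"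
    by (simp add: cscale_minus_left)
  also have "\<dots> = a"
    using assms by (simp only: hermite_coeff_add) (simp add: hermite_coeff_cscale hermite_coeff_hermite_L2)
  finally show ?thesis
    using cmod_hermite_coeff_le[of "cscale a (hermite_L2 \<mu>) - cscale b (hermite_L2 \<nu>)" \<mu>]
    by (simp add: dist_norm)
qed

text \<open>Pigeonhole on a finite net: two points in one ball of radius \<open>e / 2\<close> are
  closer than \<open>e\<close>, so each ball holds at most one.\<close>

lemma finite_if_separated_in_compact:
  fixes S :: "'a::metric_space set"
  assumes "compact K" "S \<subseteq> K" "e > 0" and sep: "\<And>x y. x \<in> S \<Longrightarrow> y \<in> S \<Longrightarrow> x \<noteq> y \<Longrightarrow> e \<le> dist x y"
  shows "finite S"
proof -
  obtain C where C: "finite C" "K \<subseteq> (\<Union>c\<in>C. ball c (e / 2))"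
    using assms(1,3) unfolding compact_eq_totally_bounded by (metis half_gt_zero)
  have "finite (S \<inter> ball c (e / 2))" for c
  proof -
    have "x = y" if "x \<in> S \<inter> ball c (e / 2)" "y \<in> S \<inter> ball c (e / 2)" for x y
      using that sep[of x y] dist_triangle_half_r[of c x e y] by force
    then show ?thesis
      by (metis finite.simps is_singletonI' is_singleton_def)
  qed
  then have "finite (\<Union>c\<in>C. S \<inter> ball c (e / 2))"
    using C(1) by blast
  moreover have "S \<subseteq> (\<Union>c\<in>C. S \<inter> ball c (e / 2))"
    using assms(2) C(2) by blast
  ultimately show ?thesis
    by (rule finite_subset [rotated])
qed

theorem theorem3p1:
  fixes m :: "nat ^ 'n \<Rightarrow> complex"
  assumes "hermite_multiplier_bounded m"
  shows "compact_operator (hermite_multiplier m) \<longleftrightarrow>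
    (m \<longlongrightarrow> 0) (filtercomap multi_index_abs at_top)"
  unfolding tendsto_multi_index_abs_iff
proof (intro iffI allI impI)
  fix e :: real
  assume T: "compact_operator (hermite_multiplier m)" and "e > 0"
  define S where "S = {\<nu>. e \<le> cmod (m \<nu>)}"
  define \<Phi> where "\<Phi> \<nu> = cscale (m \<nu>) (hermite_L2 \<nu>)" for \<nu>
  have sep: "e \<le> dist (\<Phi> \<mu>) (\<Phi> \<nu>)" if "\<mu> \<in> S" "\<mu> \<noteq> \<nu>" for \<mu> \<nu>
    using dist_cscale_hermite_L2[OF that(2), of "m \<mu>" "m \<nu>"] that(1) by (simp add: S_def \<Phi>_def)
  \<comment> \<open>The bounded set to test is the Hermite system itself, which lies on the unit
    sphere.\<close>
  have "bounded (range (hermite_L2 :: nat ^ 'n \<Rightarrow> _))"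
    by (auto simp: bounded_iff intro: exI[of _ 1])
  then have "compact (closure (hermite_multiplier m ` range hermite_L2))"
    using T by (simp add: compact_operator_def)
  moreover have "\<Phi> ` S \<subseteq> closure (hermite_multiplier m ` range hermite_L2)"
    by (rule order_trans[OF _ closure_subset]) (auto simp: \<Phi>_def hermite_multiplier_hermite_L2 image_image)
  ultimately have "finite (\<Phi> ` S)"
    using \<open>e > 0\<close> by (rule finite_if_separated_in_compact) (auto intro: sep)
  \<comment> \<open>Separation by a positive \<open>e\<close> also makes \<Phi> injective, so
    finiteness pulls back from the image to the indices.\<close>
  moreover have "inj_on \<Phi> S"
    using sep \<open>e > 0\<close> by (force intro: inj_onI)
  ultimately show "finite {\<nu>. e \<le> cmod (m \<nu>)}"
    unfolding S_def by (rule finite_imageD)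
next
  assume m: "\<forall>e>0. finite {\<nu>. e \<le> cmod (m \<nu>)}"
  have summable: "hermite_term m f summable_on UNIV" for f
    using assms by (simp add: hermite_multiplier_bounded_def)
  have "compact (closure (hermite_multiplier m ` B))" if "bounded B" for B
  proof (rule compact_closure_if_approximable)
    fix e :: real assume "e > 0"
    obtain R where R: "R > 0" "\<And>f. f \<in> B \<Longrightarrow> norm f \<le> R"
      using \<open>bounded B\<close> by (auto simp: bounded_pos)
    \<comment> \<open>With this threshold the part of the multiplier outside \<open>F\<close> has
      size at most \<open>d * R = e / 2\<close> on \<open>B\<close>, strictly below
      \<open>e\<close>.\<close>
    define d where "d = e / (2 * R)"
    have "d > 0"
      using \<open>e > 0\<close> R(1) by (simp add: d_def)
    define F where "F = {\<nu>. d \<le> cmod (m \<nu>)}"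
    have "finite F"
      using m \<open>d > 0\<close> by (simp add: F_def)
    \<comment> \<open>The witness is the sum of \<open>cmod (m \<nu>)\<close> over \<open>F\<close>,
      nonnegative even for empty \<open>F\<close>.\<close>
    obtain M where M: "\<And>\<nu>. \<nu> \<in> F \<Longrightarrow> cmod (m \<nu>) \<le> M" "M \<ge> 0"
      using \<open>finite F\<close> member_le_sum[of _ F "\<lambda>\<nu>. cmod (m \<nu>)"] sum_nonneg[of F "\<lambda>\<nu>. cmod (m \<nu>)"]
      by (metis norm_ge_zero)
    obtain K where K: "compact K"
      "\<And>a. \<forall>\<nu>\<in>F. cmod (a \<nu>) \<le> M * R \<Longrightarrow> (\<Sum>\<nu>\<in>F. cscale (a \<nu>) (hermite_L2 \<nu>)) \<in> K"
      using compact_hermite_span[OF \<open>finite F\<close>, of "M * R"] by blast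
    \<comment> \<open>The approximating point is the truncation to \<open>F\<close>; its
      coefficients are products of values of \<open>m\<close> and of Hermite coefficients, hence
      bounded by \<open>M * R\<close>.\<close>
    have "\<exists>y\<in>K. dist (hermite_multiplier m f) y < e" if "f \<in> B" for f
    proof
      have "cmod (hermite_coeff f \<nu>) \<le> R" for \<nu>
        using cmod_hermite_coeff_le[of f \<nu>] R(2)[OF that] by linarith
      then show "(\<Sum>\<nu>\<in>F. hermite_term m f \<nu>) \<in> K"
        unfolding hermite_term_def using M by (intro K(2)) (auto simp: norm_mult intro!: mult_mono)
      have "norm (hermite_multiplier m f - (\<Sum>\<nu>\<in>F. hermite_term m f \<nu>)) \<le> d * norm f"
        using summable \<open>finite F\<close> \<open>d > 0\<close> by (intro norm_hermite_multiplier_diff_le) (auto simp: F_def)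
      also have "\<dots> \<le> d * R"
        using R(2)[OF that] \<open>d > 0\<close> by simp
      also have "\<dots> < e"
        using R(1) \<open>e > 0\<close> by (simp add: d_def)
      finally show "dist (hermite_multiplier m f) (\<Sum>\<nu>\<in>F. hermite_term m f \<nu>) < e"
        by (simp add: dist_norm)
    qed
    with K(1) show "\<exists>K. compact K \<and> (\<forall>x\<in>hermite_multiplier m ` B. \<exists>y\<in>K. dist x y < e)"
      by blast
  qed
  \<comment> \<open>Linearity rests on summability for every \<open>f\<close>, which boundedness of
    the multiplier includes.\<close>
  then show "compact_operator (hermite_multiplier m)"
    by (simp add: compact_operator_def summable hermite_multiplier_add hermite_multiplier_cscale)
qed

end
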